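(* For every integer $n\geq 2$, the multipath complex $X(\mathtt{BL}_n)$ of the bidirectional linear digraph $\mathtt{BL}_n$ on $n+1$ vertices is not shellable.
   Context: A digraph has at most one edge $(v,w)$ from $v$ to $w$ for each ordered pair of vertices. For an edge $e=(v,w)$, $s(e)=v$ is its source and $t(e)=w$ its target. A simple path in a digraph is a sequence of edges $e_1,\dots,e_k$ with $s(e_{i+1})=t(e_i)$ for all $i<k$, such that $s(e_i)=s(e_j)$ or $t(e_i)=t(e_j)$ implies $i=j$, and which is not a cycle, i.e. $s(e_1)\neq t(e_k)$. A multipath of a digraph $G$ is a spanning subgraph each of whose connected components is either a single vertex or a simple path. The multipath complex $X(G)$ is the (abstract) simplicial complex whose simplices are the nonempty edge sets of multipaths of $G$ (the empty simplex corresponds to the multipath with no edges). The bidirectional linear digraph $\mathtt{BL}_n$ has $n+1$ vertices $v_0,\dots,v_n$ and the $2n$ edges $(v_i,v_{i+1})$ and $(v_{i+1},v_i)$ for $0\le i\le n-1$. Shellability is meant in the general (not necessarily pure) sense: a finite simplicial complex is shellable if its maximal faces can be ordered $F_1,\dots,F_k$ so that for every $2\le x\le k$ the subcomplex $\langle F_x\rangle\cap\bigcup_{i<x}\langle F_i\rangle$ is pure of dimension $\dim F_x-1$, where $\langle F\rangle$ denotes the complex of all faces of $F$. *)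

theory Defs
  imports "Graph_Theory.Digraph_Component"
begin

section \<open>Shellability of abstract simplicial complexes\<close>

text \<open>
  A finite abstract simplicial complex is represented by its set of faces. The empty face is
  included and has dimension \<open>-1\<close>, so that dimensions are integers.
\<close>

definition face_dim :: "'a set \<Rightarrow> int" where
  "face_dim F = int (card F) - 1"

definition facets :: "'a set set \<Rightarrow> 'a set set" where
  "facets K = {F \<in> K. \<forall>E \<in> K. F \<subseteq> E \<longrightarrow> E = F}"

definition pure_of_dim :: "'a set set \<Rightarrow> int \<Rightarrow> bool" where
  "pure_of_dim K d \<longleftrightarrow> facets K \<noteq> {} \<and> (\<forall>F \<in> facets K. face_dim F = d)"

text \<open>
  The complex \<open>\<langle>F\<rangle>\<close> of all faces of a face \<open>F\<close> is \<^term>\<open>Pow F\<close>, which contains the empty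
  face, so any intersection of such complexes is nonvoid. The list is indexed from \<open>0\<close>.
\<close>

definition shelling :: "'a set set \<Rightarrow> 'a set list \<Rightarrow> bool" where
  "shelling K Fs \<longleftrightarrow> distinct Fs \<and> set Fs = facets K \<and>
     (\<forall>x. 1 \<le> x \<and> x < length Fs \<longrightarrow>
        pure_of_dim (Pow (Fs ! x) \<inter> (\<Union>i<x. Pow (Fs ! i))) (face_dim (Fs ! x) - 1))"

definition shellable :: "'a set set \<Rightarrow> bool" where
  "shellable K \<longleftrightarrow> (\<exists>Fs. shelling K Fs)"


section \<open>Multipaths\<close>

definition simple_path :: "('a, 'b) pre_digraph \<Rightarrow> 'b list \<Rightarrow> bool" where
  "simple_path G p \<longleftrightarrow> p \<noteq> [] \<and> set p \<subseteq> arcs G \<and>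
     (\<forall>i. Suc i < length p \<longrightarrow> tail G (p ! Suc i) = head G (p ! i)) \<and>
     (\<forall>i < length p. \<forall>j < length p.
        tail G (p ! i) = tail G (p ! j) \<or> head G (p ! i) = head G (p ! j) \<longrightarrow> i = j) \<and>
     tail G (hd p) \<noteq> head G (last p)"

text \<open>
  Connected components are those of the underlying undirected graph: the library's
  \<open>Digraph_Component.connected\<close> is connectedness of the symmetric closure.
\<close>

definition connected_component :: "('a, 'b) pre_digraph \<Rightarrow> ('a, 'b) pre_digraph \<Rightarrow> bool" where
  "connected_component C G \<longleftrightarrow> pre_digraph.max_subgraph G Digraph_Component.connected C"

definition is_single_vertex :: "('a, 'b) pre_digraph \<Rightarrow> bool" where
  "is_single_vertex C \<longleftrightarrow> (\<exists>v. verts C = {v}) \<and> arcs C = {}"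

definition is_simple_path_graph :: "('a, 'b) pre_digraph \<Rightarrow> bool" where
  "is_simple_path_graph C \<longleftrightarrow>
     (\<exists>p. simple_path C p \<and> arcs C = set p \<and> verts C = tail C ` set p \<union> head C ` set p)"

definition multipath :: "'a pair_pre_digraph \<Rightarrow> 'a pair_pre_digraph \<Rightarrow> bool" where
  "multipath M G \<longleftrightarrow> spanning (with_proj M) (with_proj G) \<and>
     (\<forall>C. connected_component C (with_proj M) \<longrightarrow> is_single_vertex C \<or> is_simple_path_graph C)"

text \<open>The multipath without edges contributes the empty face.\<close>

definition multipath_complex :: "'a pair_pre_digraph \<Rightarrow> ('a \<times> 'a) set set" where
  "multipath_complex G = {parcs M | M. multipath M G}"


section \<open>The bidirectional linear digraph\<close>

definition bidir_linear :: "nat \<Rightarrow> nat pair_pre_digraph" where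
  "bidir_linear n =
     \<lparr> pverts = {0..n}, parcs = {(i, i + 1) | i. i < n} \<union> {(i + 1, i) | i. i < n} \<rparr>"

text \<open>
  \<^const>\<open>subgraph\<close> demands well-formedness of the ambient graph, so the following is needed for
  the multipath complex to contain any face at all.
\<close>

lemma pair_digraph_bidir_linear: "pair_digraph (bidir_linear n)"
proof -
  have "parcs (bidir_linear n) \<subseteq> {0..n} \<times> {0..n}"
    by (auto simp: bidir_linear_def)
  then have "finite (parcs (bidir_linear n))"
    by (rule finite_subset) auto
  then show ?thesis
    by unfold_locales (auto simp: bidir_linear_def)
qed

end

theory Submission
  imports Defs
begin

text \<open>
  The set of all forward arcs and the set of all backward arcs are two facets of the complex. Each
  arc is incompatible with at least two arcs of the opposite direction, so any other facet misses
  at least two arcs of each of them. Hence neither of the two can be attached along a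
  codimension-one face, although one of them has to come after the other in a shelling.
\<close>

section \<open>An obstruction to shellability\<close>

text \<open>Whichever of \<open>A\<close> and \<open>B\<close> comes later in a shelling shares a
  codimension-one face \<open>H\<close> with an earlier facet, so it has at most one element outside
  that facet.\<close>

lemma not_shellable_if_two_isolated_facets:
  assumes "A \<in> facets K" "B \<in> facets K" "A \<noteq> B"
    and isolated: "\<And>F E. F \<in> {A, B} \<Longrightarrow> E \<in> facets K \<Longrightarrow> E \<noteq> F \<Longrightarrow> card (F - E) \<ge> 2"
  shows "\<not> shellable K"
proof
  assume "shellable K"
  then obtain Fs where Fs: "distinct Fs" "set Fs = facets K"
    and shell: "\<And>x. 1 \<le> x \<Longrightarrow> x < length Fs \<Longrightarrow>
      pure_of_dim (Pow (Fs ! x) \<inter> (\<Union>i<x. Pow (Fs ! i))) (face_dim (Fs ! x) - 1)"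
    unfolding shellable_def shelling_def by blast
  obtain a b where "a < length Fs" "Fs ! a = A" "b < length Fs" "Fs ! b = B"
    using assms(1,2) Fs(2) by (metis in_set_conv_nth)
  \<comment> \<open>Distinct facets occupy distinct positions, so one of the two positions is
    nonzero.\<close>
  then obtain x where x: "1 \<le> x" "x < length Fs" "Fs ! x \<in> {A, B}"
    using \<open>A \<noteq> B\<close> by (metis One_nat_def insertCI leI less_Suc0)
  define F where "F = Fs ! x"
  obtain H where "H \<in> facets (Pow F \<inter> (\<Union>i<x. Pow (Fs ! i)))" and dim: "face_dim H = face_dim F - 1"
    using shell[OF x(1,2)] unfolding pure_of_dim_def F_def by blast
  then obtain i where i: "i < x" "H \<subseteq> F" "H \<subseteq> Fs ! i"
    unfolding facets_def by blast
  have cards: "card F = Suc (card H)"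
    using dim unfolding face_dim_def by linarith
  \<comment> \<open>An infinite set has \<open>card\<close> equal to 0, which is not a
    successor.\<close>
  then have "finite F"
    by (metis card.infinite nat.distinct(1))
  have "Fs ! i \<noteq> F" "Fs ! i \<in> facets K"
    using i(1) x(2) Fs nth_eq_iff_index_eq[of Fs i x] nth_mem[of i Fs] unfolding F_def by auto
  then have "2 \<le> card (F - Fs ! i)"
    using isolated x(3) unfolding F_def by blast
  also have "\<dots> \<le> card (F - H)"
    using i \<open>finite F\<close> by (intro card_mono) auto
  also have "\<dots> = 1"
    using cards i(2) \<open>finite F\<close> by (simp add: card_Diff_subset finite_subset)
  finally show False by simp
qed

section \<open>Connected components\<close>

lemma (in wf_digraph) connected_if_all_reachable:
  assumes "c \<in> verts G" "\<And>w. w \<in> verts G \<Longrightarrow> c \<rightarrow>\<^sup>*\<^bsub>mk_symmetric G\<^esub> w"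
  shows "Digraph_Component.connected G"
proof -
  interpret S: pair_wf_digraph "mk_symmetric G" ..
  have "w \<rightarrow>\<^sup>*\<^bsub>mk_symmetric G\<^esub> c" if "w \<in> verts G" for w
    using symmetric_mk_symmetric assms(2)[OF that] by (rule symmetric_reachable)
  then have "v \<rightarrow>\<^sup>*\<^bsub>mk_symmetric G\<^esub> w" if "v \<in> verts G" "w \<in> verts G" for v w
    using that assms(2) S.reachable_trans by blast
  then show ?thesis
    using assms(1) unfolding connected_def strongly_connected_def by auto
qed

text \<open>By finiteness, a connected subgraph around \<open>H\<close> with the largest total
  number of vertices and arcs exists, and it is maximal under inclusion.\<close>

lemma (in fin_digraph) connected_subgraph_in_component:
  assumes "subgraph H G" "Digraph_Component.connected H"
  obtains C where "connected_component C G" "subgraph H C"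
proof -
  let ?P = "\<lambda>C. subgraph C G \<and> Digraph_Component.connected C \<and> subgraph H C"
  let ?size = "\<lambda>C. card (verts C) + card (arcs C)"
  have "?P H"
    using assms by (auto intro: wf_digraph.subgraph_refl)
  moreover have "\<forall>C. ?P C \<longrightarrow> ?size C < Suc (?size G)"
    by (auto simp: less_Suc_eq_le intro!: add_mono card_mono)
  ultimately have "\<exists>C. ?P C \<and> (\<forall>D. ?P D \<longrightarrow> ?size D \<le> ?size C)"
    by (rule ex_has_greatest_nat[of ?P H ?size "Suc (?size G)"])
  then obtain C where C: "?P C" and max: "\<forall>D. ?P D \<longrightarrow> ?size D \<le> ?size C"
    by blast
  have "D = C" if D: "subgraph C D" "subgraph D G" "Digraph_Component.connected D" for D
  proof -
    have "finite (verts D)" "finite (arcs D)"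
      using fin_digraph_subgraph[OF D(2)] by (auto simp: fin_digraph_def fin_digraph_axioms_def)
    moreover have sub: "verts C \<subseteq> verts D" "arcs C \<subseteq> arcs D"
      using D(1) by auto
    moreover have "?size D \<le> ?size C"
      using max D C subgraph_trans by blast
    moreover have "card (verts C) \<le> card (verts D)" "card (arcs C) \<le> card (arcs D)"
      using calculation by (auto intro: card_mono)
    ultimately have "verts C = verts D" "arcs C = arcs D"
      by (simp_all add: card_subset_eq)
    \<comment> \<open>Equal vertex and arc sets do not yet give equal records; compatibility
      identifies the tail and head functions.\<close>
    then show ?thesis
      using D(1) by (auto simp: subgraph_def compatible_def)
  qed
  then have "connected_component C G"
    unfolding connected_component_def max_subgraph_def using C by blast
  then show ?thesis
    using that C by blast
qed

text \<open>The two arcs with their ends form a connected subgraph, since every vertex of it is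
  \<open>c\<close> or adjacent to \<open>c\<close>. Compatibility is recorded so that ends of arcs
  can be read in \<open>C\<close> as in the whole graph.\<close>

lemma (in fin_digraph) common_component_if_share_vertex:
  assumes "e \<in> arcs G" "f \<in> arcs G" "c \<in> {tail G e, head G e}" "c \<in> {tail G f, head G f}"
  obtains C where "connected_component C G" "e \<in> arcs C" "f \<in> arcs C" "compatible G C"
proof -
  define H where "H = \<lparr>verts = {tail G e, head G e, tail G f, head G f}, arcs = {e, f},
    tail = tail G, head = head G\<rparr>"
  interpret H: wf_digraph H
    unfolding H_def by unfold_locales auto
  interpret S: pair_wf_digraph "mk_symmetric H" ..
  have "subgraph H G"
    using assms H.wf_digraph_axioms wf_digraph_axioms
    by (auto simp: subgraph_def compatible_def H_def)
  have "w = c \<or> (c, w) \<in> parcs (mk_symmetric H)" if "w \<in> verts H" for w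
    using assms that by (auto simp: parcs_mk_symmetric H_def)
  moreover have "c \<in> verts H"
    using assms by (auto simp: H_def)
  ultimately have "c \<rightarrow>\<^sup>*\<^bsub>mk_symmetric H\<^esub> w" if "w \<in> verts H" for w
    using that S.reachable_adjI S.reachable_refl by (metis pverts_mk_symmetric)
  with \<open>c \<in> verts H\<close> have "Digraph_Component.connected H"
    by (rule H.connected_if_all_reachable)
  with \<open>subgraph H G\<close> obtain C where C: "connected_component C G" "subgraph H C"
    by (rule connected_subgraph_in_component)
  then have "e \<in> arcs C" "f \<in> arcs C"
    by (auto simp: H_def subgraph_def)
  moreover have "compatible G C"
    using C(1) by (auto simp: connected_component_def pre_digraph.max_subgraph_def)
  ultimately show ?thesis
    using C(1) that by blast
qed

section \<open>Arcs that exclude each other in a multipath\<close>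

lemma simple_path_arcs:
  assumes "simple_path C p" "e \<in> set p" "f \<in> set p"
  shows "tail C e = tail C f \<Longrightarrow> e = f" "head C e = head C f \<Longrightarrow> e = f"
    and "\<not> (tail C e = head C f \<and> head C e = tail C f)"
proof -
  have step: "\<And>i. Suc i < length p \<Longrightarrow> tail C (p ! Suc i) = head C (p ! i)"
    and inj: "\<And>i j. i < length p \<Longrightarrow> j < length p \<Longrightarrow>
      tail C (p ! i) = tail C (p ! j) \<or> head C (p ! i) = head C (p ! j) \<Longrightarrow> i = j"
    and ends: "tail C (hd p) \<noteq> head C (last p)" and "p \<noteq> []"
    using assms(1) unfolding simple_path_def by blast+
  obtain i j where i: "i < length p" "p ! i = e" and j: "j < length p" "p ! j = f"
    using assms(2,3) by (metis in_set_conv_nth)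
  show "tail C e = tail C f \<Longrightarrow> e = f" "head C e = head C f \<Longrightarrow> e = f"
    using inj i j by blast+
  text \<open>Mutually inverse arcs would make the last arc of the path end at the start of the first.\<close>
  have no_inverse: "Suc k \<noteq> length p"
    if "k < length p" "l < length p" "tail C (p ! k) = head C (p ! l)" "head C (p ! k) = tail C (p ! l)"
    for k l
  proof
    assume last: "Suc k = length p"
    show False
    proof (cases l)
      case 0
      have "hd p = p ! l" "last p = p ! k"
        using 0 last \<open>p \<noteq> []\<close> by (auto simp: hd_conv_nth last_conv_nth simp flip: last)
      then show False
        using ends that by simp
    next
      \<comment> \<open>The predecessor of \<open>p ! l\<close> ends where \<open>p ! k\<close>
        ends, hence is \<open>p ! k\<close>; then \<open>l\<close> would lie beyond the end of the
        list.\<close>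
      case (Suc m)
      then have "head C (p ! m) = head C (p ! k)"
        using step[of m] that by simp
      then have "m = k"
        using inj[of m k] Suc that by simp
      then show False
        using Suc that last by simp
    qed
  qed
  show "\<not> (tail C e = head C f \<and> head C e = tail C f)"
  proof
    assume inv: "tail C e = head C f \<and> head C e = tail C f"
    have "Suc i < length p" "Suc j < length p"
      using no_inverse[of i j] no_inverse[of j i] inv i j by auto
    \<comment> \<open>The successor of \<open>p ! i\<close> starts at the head of \<open>e\<close>,
      which is the tail of \<open>f\<close>, so it is \<open>p ! j\<close>; the same holds with the
      roles exchanged.\<close>
    then have "Suc i = j" "Suc j = i"
      using inv i j step[of i] step[of j] inj[of "Suc i" j] inj[of "Suc j" i] by auto
    then show False by simp
  qed
qed

text \<open>Each forbidden configuration involves two arcs with a common vertex. These lie in one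
  component, which has an arc and is therefore a simple path.\<close>

lemma multipath_arcs:
  assumes "multipath M G" "finite (parcs G)" "finite (pverts G)" "e \<in> parcs M" "f \<in> parcs M"
  shows "fst e = fst f \<Longrightarrow> e = f" "snd e = snd f \<Longrightarrow> e = f"
    and "\<not> (fst e = snd f \<and> snd e = fst f)"
proof -
  have "spanning (with_proj M) (with_proj G)"
    using assms(1) unfolding multipath_def by blast
  then have "wf_digraph (with_proj M)" "parcs M \<subseteq> parcs G" "pverts M = pverts G"
    by (auto simp: spanning_def subgraph_def)
  moreover from this have "finite (parcs M)"
    using assms(2) finite_subset by blast
  ultimately interpret fin_digraph "with_proj M"
    using assms(3) by (auto intro!: fin_digraph.intro fin_digraph_axioms.intro)
  have *: "\<exists>C p. simple_path C p \<and> e \<in> set p \<and> f \<in> set p \<and> tail C = fst \<and> head C = snd"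
    if c: "c \<in> {fst e, snd e}" "c \<in> {fst f, snd f}" for c
  proof -
    obtain C where C: "connected_component C (with_proj M)" "e \<in> arcs C" "f \<in> arcs C"
      and "compatible (with_proj M) C"
      by (rule common_component_if_share_vertex[of e f c]) (use c assms(4,5) in simp_all)
    moreover from C have "is_simple_path_graph C"
      using assms(1) unfolding multipath_def is_single_vertex_def by blast
    moreover have "tail C = fst" "head C = snd"
      using \<open>compatible (with_proj M) C\<close> by (auto simp: compatible_def)
    ultimately show ?thesis
      unfolding is_simple_path_graph_def by metis
  qed
  show "e = f" if "fst e = fst f"
    using *[of "fst e"] that simple_path_arcs(1) by (metis insertCI)
  show "e = f" if "snd e = snd f"
    using *[of "snd e"] that simple_path_arcs(2) by (metis insertCI)
  show "\<not> (fst e = snd f \<and> snd e = fst f)"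
    using *[of "fst e"] simple_path_arcs(3) by (metis insertCI)
qed

section \<open>Hamiltonian paths as faces\<close>

text \<open>The path is connected and visits every vertex, so it is its own only component. The
  enumeration \<open>v\<close> is left arbitrary in order to cover both directions of the linear
  digraph.\<close>

lemma hamiltonian_path_in_multipath_complex:
  fixes v :: "nat \<Rightarrow> 'a"
  assumes "wf_digraph (with_proj G)" "0 < n" "inj_on v {..n}" "pverts G = v ` {..n}"
    and arcs: "\<And>i. i < n \<Longrightarrow> (v i, v (Suc i)) \<in> parcs G"
  shows "(\<lambda>i. (v i, v (Suc i))) ` {..<n} \<in> multipath_complex G"
proof -
  define M where "M = \<lparr>pverts = v ` {..n}, parcs = (\<lambda>i. (v i, v (Suc i))) ` {..<n}\<rparr>"
  interpret M: wf_digraph "with_proj M"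
    unfolding M_def by unfold_locales auto
  interpret S: pair_wf_digraph "mk_symmetric (with_proj M)" ..
  have spanning: "spanning (with_proj M) (with_proj G)"
    using assms M.wf_digraph_axioms by (auto simp: spanning_def subgraph_def compatible_def M_def)
  have reach: "v 0 \<rightarrow>\<^sup>*\<^bsub>mk_symmetric (with_proj M)\<^esub> v i" if "i \<le> n" for i
    using that
  proof (induction i)
    case 0
    then show ?case
      by (intro S.reachable_refl) (simp add: M_def)
  next
    case (Suc i)
    then have "(v i, v (Suc i)) \<in> parcs (mk_symmetric (with_proj M))"
      by (force simp: parcs_mk_symmetric M_def)
    with Suc show ?case
      using S.reachable_adj_trans by simp
  qed
  have connected: "Digraph_Component.connected (with_proj M)"
    by (rule M.connected_if_all_reachable[of "v 0"]) (use reach in \<open>auto simp: M_def\<close>)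
  define p where "p = map (\<lambda>i. (v i, v (Suc i))) [0..<n]"
  have "i = j" if "v i = v j" "i \<le> n" "j \<le> n" for i j
    using assms(3) that by (auto dest: inj_onD)
  then have inj: "v i = v j \<longleftrightarrow> i = j" if "i \<le> n" "j \<le> n" for i j
    using that by blast
  have "hd p = (v 0, v 1)" "last p = (v (n - 1), v n)"
    using \<open>0 < n\<close> by (auto simp: p_def hd_map last_map)
  then have "simple_path (with_proj M) p"
    using \<open>0 < n\<close> unfolding simple_path_def by (auto simp: p_def M_def inj)
  \<comment> \<open>Tails account for the indices below \<open>n\<close>, heads for the positive
    ones.\<close>
  moreover have "{..n} = {..<n} \<union> Suc ` {..<n}"
    using \<open>0 < n\<close> by (auto simp: image_Suc_lessThan)
  then have "v ` {..n} = v ` {..<n} \<union> (\<lambda>i. v (Suc i)) ` {..<n}"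
    by (simp add: image_Un image_image)
  ultimately have "is_simple_path_graph (with_proj M)"
    unfolding is_simple_path_graph_def
    by (intro exI[of _ p]) (auto simp: p_def M_def image_image atLeast0LessThan)
  \<comment> \<open>As \<open>M\<close> itself is connected, maximality leaves no smaller
    component.\<close>
  moreover have "C = with_proj M" if "connected_component C (with_proj M)" for C
    using that connected M.subgraph_refl
    unfolding connected_component_def pre_digraph.max_subgraph_def by metis
  ultimately have "multipath M G"
    using spanning unfolding multipath_def by blast
  then show ?thesis
    unfolding multipath_complex_def mem_Collect_eq by (intro exI[of _ M]) (simp add: M_def)
qed

section \<open>The forward and backward facets\<close>

theorem proposition3p2:
  fixes n :: nat
  assumes "n \<ge> 2"
  shows "\<not> shellable (multipath_complex (bidir_linear n))"
proof -
  let ?G = "bidir_linear n"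
  define K where "K = multipath_complex ?G"
  define A where "A = (\<lambda>i. (i, Suc i)) ` {..<n}"
  define B where "B = (\<lambda>i. (Suc i, i)) ` {..<n}"
  interpret pair_digraph ?G
    by (rule pair_digraph_bidir_linear)
  have K_sub: "E \<subseteq> A \<union> B" if "E \<in> K" for E
    using that unfolding K_def multipath_complex_def multipath_def spanning_def subgraph_def
    by (force simp: bidir_linear_def A_def B_def)
  have conflict: "fst e = fst f \<Longrightarrow> e = f" "snd e = snd f \<Longrightarrow> e = f"
      "\<not> (fst e = snd f \<and> snd e = fst f)" if "E \<in> K" "e \<in> E" "f \<in> E" for E e f
    using that multipath_arcs[of _ ?G e f] pair_finite_arcs pair_finite_verts
    unfolding K_def multipath_complex_def by blast+
  \<comment> \<open>The three cases are mutually inverse arcs, a common head and a common tail, in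
    this order.\<close>
  have opposite: "(Suc i, i) \<notin> E \<or> (j, Suc j) \<notin> E"
    if "E \<in> K" "i = j \<or> i = Suc j \<or> j = Suc i" for E i j
    using conflict[OF that(1), of "(Suc i, i)" "(j, Suc j)"] that(2) by auto
  \<comment> \<open>Here \<open>n \<ge> 2\<close> provides a second position next to
    \<open>i\<close>: position 1 for \<open>i = 0\<close>, and \<open>i - 1\<close>
    otherwise.\<close>
  have neighbour: "\<exists>j<n. i = Suc j \<or> j = Suc i" if "i < n" for i
    using that assms by (intro exI[of _ "if i = 0 then 1 else i - 1"]) auto
  \<comment> \<open>A forward arc at \<open>i\<close> excludes the backward arcs at \<open>i\<close>
    and at a neighbouring position \<open>j\<close>.\<close>
  have missB: "card (B - E) \<ge> 2" if E: "E \<in> K" "\<not> E \<subseteq> B" for E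
  proof -
    obtain i where i: "i < n" "(i, Suc i) \<in> E"
      using K_sub E unfolding A_def by blast
    obtain j where j: "j < n" "i = Suc j \<or> j = Suc i"
      using neighbour[OF i(1)] by blast
    have "{(Suc i, i), (Suc j, j)} \<subseteq> B - E"
      using i j opposite[OF E(1)] by (auto simp: B_def)
    then have "card {(Suc i, i), (Suc j, j)} \<le> card (B - E)"
      by (intro card_mono) (auto simp: B_def)
    then show ?thesis using j by auto
  qed
  have missA: "card (A - E) \<ge> 2" if E: "E \<in> K" "\<not> E \<subseteq> A" for E
  proof -
    obtain i where i: "i < n" "(Suc i, i) \<in> E"
      using K_sub E unfolding B_def by blast
    obtain j where j: "j < n" "i = Suc j \<or> j = Suc i"
      using neighbour[OF i(1)] by blast
    have "{(i, Suc i), (j, Suc j)} \<subseteq> A - E"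
      using i j opposite[OF E(1)] by (auto simp: A_def)
    then have "card {(i, Suc i), (j, Suc j)} \<le> card (A - E)"
      by (intro card_mono) (auto simp: A_def)
    then show ?thesis using j by auto
  qed
  have "A \<in> K"
    using hamiltonian_path_in_multipath_complex[of ?G n "\<lambda>i. i"] assms wf_digraph_axioms
    unfolding K_def A_def by (auto simp: bidir_linear_def atLeast0AtMost)
  \<comment> \<open>Listing the vertices in reverse order turns the Hamiltonian path into the
    backward one; reindexing by \<open>n - Suc i\<close> then identifies its arc set with
    \<open>B\<close>.\<close>
  have "(\<lambda>i. (n - i, n - Suc i)) ` {..<n} \<in> K"
    unfolding K_def
  proof (rule hamiltonian_path_in_multipath_complex[of ?G n "\<lambda>i. n - i"])
    show "inj_on ((-) n) {..n}"
      by (auto simp: inj_on_def)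
    have "(-) n ` {..n} = {..n}"
      by (rule endo_inj_surj) (auto simp: inj_on_def)
    then show "pverts ?G = (-) n ` {..n}"
      by (simp add: bidir_linear_def atLeast0AtMost)
    show "(n - i, n - Suc i) \<in> parcs ?G" if "i < n" for i
      using that by (auto simp: bidir_linear_def intro!: exI[of _ "n - Suc i"])
  qed (use assms wf_digraph_axioms in auto)
  also have "(\<lambda>i. (n - i, n - Suc i)) ` {..<n} = (\<lambda>i. (Suc i, i)) ` (\<lambda>i. n - Suc i) ` {..<n}"
    by (auto simp: image_image Suc_diff_Suc intro!: image_cong)
  also have "(\<lambda>i. n - Suc i) ` {..<n} = {..<n}"
    by (rule endo_inj_surj) (auto simp: inj_on_def)
  finally have "B \<in> K"
    unfolding B_def .
  \<comment> \<open>A face containing \<open>F\<close> misses nothing of it, so it cannot have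
    elements outside \<open>F\<close>.\<close>
  have facetI: "F \<in> facets K"
    if "F \<in> K" and miss: "\<And>E. E \<in> K \<Longrightarrow> \<not> E \<subseteq> F \<Longrightarrow> card (F - E) \<ge> 2" for F
  proof -
    have "E = F" if "E \<in> K" "F \<subseteq> E" for E
    proof -
      have "card (F - E) = 0"
        using that(2) by (simp add: Diff_eq_empty_iff[THEN iffD2])
      then have "E \<subseteq> F"
        using miss[OF that(1)] by linarith
      then show ?thesis
        using that(2) by blast
    qed
    then show ?thesis
      unfolding facets_def using \<open>F \<in> K\<close> by blast
  qed
  have facetA: "A \<in> facets K"
    using \<open>A \<in> K\<close> missA by (rule facetI)
  have facetB: "B \<in> facets K"
    using \<open>B \<in> K\<close> missB by (rule facetI)
  have "(0, 1) \<in> A - B"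
    using assms by (auto simp: A_def B_def)
  then have "A \<noteq> B" by blast
  have "card (F - E) \<ge> 2" if "F \<in> {A, B}" "E \<in> facets K" "E \<noteq> F" for F E
  proof -
    \<comment> \<open>By maximality, a facet \<open>E\<close> inside the face \<open>F\<close> would
      equal \<open>F\<close>.\<close>
    have "E \<in> K" "\<not> E \<subseteq> F"
      using that facetA facetB unfolding facets_def by auto
    then show ?thesis
      using that(1) missA missB by blast
  qed
  with facetA facetB \<open>A \<noteq> B\<close> show ?thesis
    unfolding K_def[symmetric] by (rule not_shellable_if_two_isolated_facets)
qed

end
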